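(* Let $\alpha>0$ and let $(z,u,p)$ be the exact solution triple of the optimality system $$-\Delta z-u=f \text{ in }\Omega,\quad z=0\text{ on }\partial\Omega;\qquad -\Delta p+z=g\text{ in }\Omega,\quad p=0\text{ on }\partial\Omega;\qquad \alpha u-p=0\text{ in }\Omega,$$ where $\Omega=(0,1)^2$. Suppose $\{z,u,p\}\subset C^4(\overline\Omega)$. Then the finite difference scheme $$-\Delta_h z_h-u_h=f_h,\qquad -\Delta_h p_h+z_h=g_h,\qquad \alpha u_h-p_h=0$$ has second-order accuracy with respect to the infinity norm: there is a constant $C>0$, independent of $h$, such that for every $h=1/N$ (integer $N\ge 2$) the solution $(z_h,u_h,p_h)$ of the scheme satisfies $$\|z-z_h\|_\infty\le Ch^2,\qquad \|u-u_h\|_\infty\le Ch^2,\qquad \|p-p_h\|_\infty\le Ch^2,$$ where $z,u,p$ are evaluated at the interior grid points.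
   Context: The system is the first-order optimality (KKT) system of minimizing $\frac12\int_\Omega (z-g)^2dx+\frac{\alpha}{2}\int_\Omega u^2dx$ over $u\in L^2(\Omega)$ subject to $-\Delta z=u+f$ in $\Omega$, $z=0$ on $\partial\Omega$, with $f,g\in L^2(\Omega)$; $p$ is the adjoint state. Under the stated regularity, $f$ and $g$ are identified with their continuous representatives on $\overline\Omega$. Grid: $h=1/N$, grid points $(x_i,y_j)=(ih,jh)$, $0\le i,j\le N$; $\Omega_h$ is the set of interior grid points ($1\le i,j\le N-1$). $z_h,u_h,p_h$ are grid functions on $\Omega_h$ (vectors), and $f_h,g_h$ are the restrictions of $f,g$ to $\Omega_h$. $\Delta_h$ is the 5-point discrete Laplacian matrix with homogeneous Dirichlet boundary conditions: $(\Delta_h v)_{ij}=h^{-2}(v_{i+1,j}+v_{i-1,j}+v_{i,j+1}+v_{i,j-1}-4v_{ij})$ for $1\le i,j\le N-1$, where $v$ is set to $0$ at boundary nodes. $\|v\|_\infty=\max_{1\le i,j\le N-1}|v_{ij}|$. *)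

theory Defs
  imports "HOL-Analysis.Analysis"
begin

definition Omega :: "(real \<times> real) set" where
  "Omega = {0<..<1} \<times> {0<..<1}"

(* C^k of the closure of an open set U: all partial derivatives up to order k exist in U and
   extend continuously to closure U.  The witnesses vx and vy are these extensions of the first
   partial derivatives; on closure U they are determined by v. *)
primrec Ck_closure :: "nat \<Rightarrow> (real \<times> real) set \<Rightarrow> (real \<times> real \<Rightarrow> real) \<Rightarrow> bool" where
  "Ck_closure 0 U v \<longleftrightarrow> continuous_on (closure U) v"
| "Ck_closure (Suc k) U v \<longleftrightarrow> continuous_on (closure U) v \<and>
     (\<exists>vx vy. Ck_closure k U vx \<and> Ck_closure k U vy \<and>
       (\<forall>x y. (x, y) \<in> U \<longrightarrow>
          ((\<lambda>s. v (s, y)) has_real_derivative vx (x, y)) (at x) \<and>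
          ((\<lambda>t. v (x, t)) has_real_derivative vy (x, y)) (at y)))"

definition laplacian :: "(real \<times> real \<Rightarrow> real) \<Rightarrow> real \<times> real \<Rightarrow> real" where
  "laplacian v = (\<lambda>(x, y). deriv (deriv (\<lambda>s. v (s, y))) x + deriv (deriv (\<lambda>t. v (x, t))) y)"

(* The equations are read pointwise (classically): f and g stand for the continuous
   representatives of the L^2 data. *)
definition optimality_system ::
  "real \<Rightarrow> (real \<times> real \<Rightarrow> real) \<Rightarrow> (real \<times> real \<Rightarrow> real) \<Rightarrow>
   (real \<times> real \<Rightarrow> real) \<Rightarrow> (real \<times> real \<Rightarrow> real) \<Rightarrow> (real \<times> real \<Rightarrow> real) \<Rightarrow> bool" where
  "optimality_system \<alpha> f g z u p \<longleftrightarrow>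
     (\<forall>x\<in>Omega. - laplacian z x - u x = f x) \<and> (\<forall>x\<in>frontier Omega. z x = 0) \<and>
     (\<forall>x\<in>Omega. - laplacian p x + z x = g x) \<and> (\<forall>x\<in>frontier Omega. p x = 0) \<and>
     (\<forall>x\<in>Omega. \<alpha> * u x - p x = 0)"

(* All grid objects are parametrised by N, with h = 1/N. *)
definition Omega_h :: "nat \<Rightarrow> (nat \<times> nat) set" where
  "Omega_h N = {1..N-1} \<times> {1..N-1}"

definition grid_point :: "nat \<Rightarrow> nat \<times> nat \<Rightarrow> real \<times> real" where
  "grid_point N = (\<lambda>(i, j). (real i / real N, real j / real N))"

(* Vectors on the interior grid are represented by their extension by zero; this supplies the
   homogeneous boundary values used by the 5-point stencil and makes the representation unique. *)
definition grid_function :: "nat \<Rightarrow> (nat \<times> nat \<Rightarrow> real) \<Rightarrow> bool" where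
  "grid_function N v \<longleftrightarrow> (\<forall>ij. ij \<notin> Omega_h N \<longrightarrow> v ij = 0)"

(* Only meant for (i, j) in Omega_h N, where i - 1 and j - 1 are not truncated. *)
definition laplacian_h :: "nat \<Rightarrow> (nat \<times> nat \<Rightarrow> real) \<Rightarrow> nat \<times> nat \<Rightarrow> real" where
  "laplacian_h N v = (\<lambda>(i, j).
     (v (i + 1, j) + v (i - 1, j) + v (i, j + 1) + v (i, j - 1) - 4 * v (i, j)) / (1 / real N)\<^sup>2)"

definition fd_scheme ::
  "real \<Rightarrow> (real \<times> real \<Rightarrow> real) \<Rightarrow> (real \<times> real \<Rightarrow> real) \<Rightarrow> nat \<Rightarrow>
   (nat \<times> nat \<Rightarrow> real) \<Rightarrow> (nat \<times> nat \<Rightarrow> real) \<Rightarrow> (nat \<times> nat \<Rightarrow> real) \<Rightarrow> bool" where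
  "fd_scheme \<alpha> f g N z\<^sub>h u\<^sub>h p\<^sub>h \<longleftrightarrow>
     grid_function N z\<^sub>h \<and> grid_function N u\<^sub>h \<and> grid_function N p\<^sub>h \<and>
     (\<forall>ij\<in>Omega_h N. - laplacian_h N z\<^sub>h ij - u\<^sub>h ij = f (grid_point N ij)) \<and>
     (\<forall>ij\<in>Omega_h N. - laplacian_h N p\<^sub>h ij + z\<^sub>h ij = g (grid_point N ij)) \<and>
     (\<forall>ij\<in>Omega_h N. \<alpha> * u\<^sub>h ij - p\<^sub>h ij = 0)"

definition inf_norm :: "nat \<Rightarrow> (nat \<times> nat \<Rightarrow> real) \<Rightarrow> real" where
  "inf_norm N v = Max ((\<lambda>ij. \<bar>v ij\<bar>) ` Omega_h N)"

definition grid_error :: "nat \<Rightarrow> (real \<times> real \<Rightarrow> real) \<Rightarrow> (nat \<times> nat \<Rightarrow> real) \<Rightarrow> real" where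
  "grid_error N v v\<^sub>h = inf_norm N (\<lambda>ij. v (grid_point N ij) - v\<^sub>h ij)"

end

theory Submission
  imports Defs
begin

text \<open>
  The five-point stencil is consistent to second order, so the theorem reduces to a stability
  estimate in the maximum norm. The errors \<open>a\<close> of the state and \<open>b\<close> of the adjoint state solve
  \<open>- \<Delta>\<^sub>h a - b / \<alpha> = r\<close> and \<open>- \<Delta>\<^sub>h b + a = s\<close> with \<open>r\<close> and \<open>s\<close> of size \<open>O(h\<^sup>2)\<close>. The coupling
  terms have opposite signs, so the discrete maximum principle does not apply to this system. The
  estimate is obtained in two steps.

  \<^item> Energy (\<open>energy_estimate\<close>). Pair the second equation with \<open>a\<close>, the first one with \<open>b\<close>, and
    subtract: as \<open>\<Delta>\<^sub>h\<close> is symmetric, the difference operators cancel and what remains is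
    \<open>\<parallel>a\<parallel>\<^sup>2 + \<parallel>b\<parallel>\<^sup>2 / \<alpha> = \<langle>s, a\<rangle> - \<langle>r, b\<rangle>\<close>. This bounds \<open>a\<close> and \<open>b\<close> in the discrete \<open>L\<^sup>2\<close> norm, hence
    also \<open>\<Delta>\<^sub>h a\<close> and \<open>\<Delta>\<^sub>h b\<close>, which the equations express through \<open>a\<close>, \<open>b\<close>, \<open>r\<close> and \<open>s\<close>.

  \<^item> From \<open>L\<^sup>2\<close> to the maximum (\<open>discrete_sobolev\<close>). A grid function with zero boundary values
    satisfies \<open>\<parallel>v\<parallel>\<^sub>\<infinity> \<le> \<parallel>\<Delta>\<^sub>h v\<parallel> / 2\<close>. On the one hand \<open>v\<close> is the double sum of its mixed differences
    \<open>D\<^sub>x D\<^sub>y v\<close>, so it is bounded by their \<open>L\<^sup>2\<close> norm. On the other hand two summations by parts give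
    \<open>\<langle>\<delta>\<^sub>x\<^sup>2 v, \<delta>\<^sub>y\<^sup>2 v\<rangle> = \<parallel>D\<^sub>x D\<^sub>y v\<parallel>\<^sup>2\<close>, and \<open>4 \<delta>\<^sub>x\<^sup>2 v \<cdot> \<delta>\<^sub>y\<^sup>2 v \<le> (\<Delta>\<^sub>h v)\<^sup>2\<close> pointwise.

  Together they give \<open>stability\<close>. Applied to a homogeneous system it shows that the scheme has at
  most one solution; since the scheme is a square linear system, it then has exactly one.
\<close>

section \<open>Square linear systems\<close>

text \<open>
  Gaussian elimination, one equation at a time: an equation that is not identically zero has a
  pivot \<open>k\<close>, which is solved for and substituted into the others. This removes one unknown together
  with one equation, so the unknowns remain in the majority.
\<close>

lemma underdetermined_system_nontrivial_solution:
  fixes a :: "'j \<Rightarrow> 'i \<Rightarrow> real"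
  assumes "finite J" "finite I" "card J < card I"
  shows "\<exists>x. (\<exists>i\<in>I. x i \<noteq> 0) \<and> (\<forall>j\<in>J. (\<Sum>i\<in>I. a j i * x i) = 0)"
  using assms
proof (induction J arbitrary: I a rule: finite_induct)
  case empty
  then have "I \<noteq> {}" by auto
  then show ?case by (intro exI[of _ "\<lambda>_. 1"]) auto
next
  case (insert j J)
  show ?case
  proof (cases "\<forall>i\<in>I. a j i = 0")
    case True
    have "card J < card I" using insert by simp
    from insert.IH[OF insert.prems(1) this, of a] True show ?thesis by auto
  next
    case False
    then obtain k where k: "k \<in> I" "a j k \<noteq> 0" by blast
    define I' where "I' = I - {k}"
    have fin: "finite I'" and I: "I = insert k I'" "k \<notin> I'"
      using insert.prems k by (auto simp: I'_def)
    have "card J < card I'" using insert.prems insert.hyps I fin by simp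
    from insert.IH[OF fin this, of "\<lambda>j' i. a j' i - a j' k * a j i / a j k"]
    obtain y where y: "\<exists>i\<in>I'. y i \<noteq> 0"
      "\<And>j'. j' \<in> J \<Longrightarrow> (\<Sum>i\<in>I'. (a j' i - a j' k * a j i / a j k) * y i) = 0" by blast
    define c where "c = - (\<Sum>i\<in>I'. a j i * y i) / a j k"
    have sum_eq: "(\<Sum>i\<in>I. b i * (y(k := c)) i) = b k * c + (\<Sum>i\<in>I'. b i * y i)" for b
    proof -
      have "(\<Sum>i\<in>I'. b i * (y(k := c)) i) = (\<Sum>i\<in>I'. b i * y i)"
        using I(2) by (intro sum.cong) auto
      then show ?thesis using I fin by simp
    qed
    have "(\<Sum>i\<in>I. a j i * (y(k := c)) i) = 0"
      unfolding sum_eq using k by (simp add: c_def)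
    moreover have "(\<Sum>i\<in>I. a j' i * (y(k := c)) i) = 0" if "j' \<in> J" for j'
    proof -
      have "(\<Sum>i\<in>I'. (a j' i - a j' k * a j i / a j k) * y i) =
          (\<Sum>i\<in>I'. a j' i * y i) + a j' k * c"
        by (simp add: c_def sum_subtractf algebra_simps sum_distrib_left sum_divide_distrib)
      then show ?thesis unfolding sum_eq using y(2)[OF that] by simp
    qed
    moreover have "\<exists>i\<in>I. (y(k := c)) i \<noteq> 0" using y(1) I by auto
    ultimately show ?thesis by (intro exI[of _ "y(k := c)"]) auto
  qed
qed

text \<open>
  With one further unknown \<open>t\<close>, the homogeneous system \<open>A x - t b = 0\<close> is underdetermined and has a
  nontrivial solution. There \<open>t \<noteq> 0\<close>, for otherwise \<open>A x = 0\<close> would force \<open>x = 0\<close>; dividing by \<open>t\<close>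
  solves \<open>A x = b\<close>. The unknown \<open>t\<close> is the one with index \<open>None\<close>.
\<close>

lemma square_system_solvable:
  fixes a :: "'i \<Rightarrow> 'i \<Rightarrow> real"
  assumes fin: "finite I"
    and inj: "\<And>x. \<forall>j\<in>I. (\<Sum>i\<in>I. a j i * x i) = 0 \<Longrightarrow> \<forall>i\<in>I. x i = 0"
  shows "\<exists>x. \<forall>j\<in>I. (\<Sum>i\<in>I. a j i * x i) = b j"
proof -
  define a' where "a' j i = (case i of None \<Rightarrow> - b j | Some i \<Rightarrow> a j i)" for j i
  have "card I < card (insert None (Some ` I))"
    using fin by (simp add: card_image image_iff)
  from underdetermined_system_nontrivial_solution[OF fin _ this, of a']
  obtain x where x: "\<exists>i\<in>insert None (Some ` I). x i \<noteq> 0"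
    "\<And>j. j \<in> I \<Longrightarrow> (\<Sum>i\<in>insert None (Some ` I). a' j i * x i) = 0" using fin by auto
  have eq: "(\<Sum>i\<in>I. a j i * x (Some i)) = b j * x None" if "j \<in> I" for j
    using x(2)[OF that] fin by (simp add: a'_def sum.reindex image_iff)
  have "x None \<noteq> 0"
  proof
    assume 0: "x None = 0"
    have "\<forall>i\<in>I. x (Some i) = 0" by (rule inj) (simp add: eq 0)
    then show False using x(1) 0 by auto
  qed
  then have "\<forall>j\<in>I. (\<Sum>i\<in>I. a j i * (x (Some i) / x None)) = b j"
    using eq by (simp add: sum_divide_distrib[symmetric])
  then show ?thesis by (intro exI[of _ "\<lambda>i. x (Some i) / x None"])
qed

text \<open>
  A form that does not mention matrices, so that \<open>T\<close> can be a difference operator. The vectors indexed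
  by \<open>I\<close> are represented by their extensions by zero; the matrix of \<open>T\<close> is read off from the images
  of the unit vectors.
\<close>

lemma injective_linear_map_surjective:
  fixes T :: "('i \<Rightarrow> real) \<Rightarrow> 'i \<Rightarrow> real"
  assumes fin: "finite I"
    and add: "\<And>x y j. T (\<lambda>i. x i + y i) j = T x j + T y j"
    and scale: "\<And>c x j. T (\<lambda>i. c * x i) j = c * T x j"
    and inj: "\<And>x. \<lbrakk>\<forall>i. i \<notin> I \<longrightarrow> x i = 0; \<forall>j\<in>I. T x j = 0\<rbrakk> \<Longrightarrow> \<forall>i\<in>I. x i = 0"
  shows "\<exists>x. (\<forall>i. i \<notin> I \<longrightarrow> x i = 0) \<and> (\<forall>j\<in>I. T x j = b j)"
proof -
  define e :: "'i \<Rightarrow> 'i \<Rightarrow> real" where "e k = (\<lambda>i. if i = k then 1 else 0)" for k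
  have T0: "T (\<lambda>i. 0) j = 0" for j using scale[of 0 "\<lambda>_. 0"] by simp
  have T_sum: "T (\<lambda>i. \<Sum>k\<in>K. x k * e k i) j = (\<Sum>k\<in>K. T (e k) j * x k)" if "finite K" for K x j
    using that by (induction K rule: finite_induct) (simp_all add: T0 add scale mult.commute)
  have expand: "(\<Sum>k\<in>I. x k * e k i) = (if i \<in> I then x i else 0)" for x i
    using fin by (simp add: e_def if_distrib cong: if_cong)
  have mat: "T (\<lambda>i. if i \<in> I then x i else 0) j = (\<Sum>k\<in>I. T (e k) j * x k)" for x j
    using T_sum[OF fin, of x j] by (simp add: expand)
  have "\<exists>x. \<forall>j\<in>I. (\<Sum>k\<in>I. T (e k) j * x k) = b j"
  proof (rule square_system_solvable[OF fin])
    fix x assume *: "\<forall>j\<in>I. (\<Sum>k\<in>I. T (e k) j * x k) = 0"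
    have "\<forall>i\<in>I. (if i \<in> I then x i else 0) = 0"
      by (rule inj) (use * in \<open>auto simp: mat\<close>)
    then show "\<forall>i\<in>I. x i = 0" by auto
  qed
  then obtain x where "\<forall>j\<in>I. (\<Sum>k\<in>I. T (e k) j * x k) = b j" by blast
  then show ?thesis by (intro exI[of _ "\<lambda>i. if i \<in> I then x i else 0"]) (auto simp: mat)
qed

section \<open>Discrete calculus on the grid\<close>

definition second_diff :: "(nat \<Rightarrow> real) \<Rightarrow> nat \<Rightarrow> real" where
  "second_diff v i = v (i + 1) + v (i - 1) - 2 * v i"

lemma laplacian_h_second_diff:
  "laplacian_h N v (i, j) =
     (real N)\<^sup>2 * (second_diff (\<lambda>k. v (k, j)) i + second_diff (\<lambda>l. v (i, l)) j)"
  by (cases "N = 0") (simp_all add: laplacian_h_def second_diff_def field_simps)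

text \<open>
  Only \<open>u\<close> has to vanish at the end points: the boundary terms left over by the telescoping contain
  a boundary value of \<open>u\<close> as a factor.
\<close>

lemma summation_by_parts:
  fixes u v :: "nat \<Rightarrow> real"
  assumes "u 0 = 0" "u N = 0"
  shows "(\<Sum>i=1..<N. u i * second_diff v i) = - (\<Sum>i<N. (u (i + 1) - u i) * (v (i + 1) - v i))"
proof (cases N)
  case (Suc n)
  \<comment> \<open>For an upper limit where \<open>u\<close> may be nonzero, one boundary term remains; with it the
     identity can be proved by induction.\<close>
  have "(\<Sum>i=1..<Suc n. u i * second_diff v i) =
      u (Suc n) * (v (Suc n) - v n) - (\<Sum>i<Suc n. (u (i + 1) - u i) * (v (i + 1) - v i))" for n
    using assms(1) by (induction n) (simp_all add: second_diff_def algebra_simps)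
  then show ?thesis using Suc assms(2) by simp
qed simp

lemma second_diff_symmetric:
  assumes "u 0 = 0" "u N = 0" "v 0 = 0" "v N = 0"
  shows "(\<Sum>i=1..<N. u i * second_diff v i) = (\<Sum>i=1..<N. second_diff u i * v i)"
  using summation_by_parts[of u N v] summation_by_parts[of v N u] assms by (simp add: mult.commute)

lemma sum_Omega_h: "(\<Sum>ij\<in>Omega_h N. F ij) = (\<Sum>i=1..<N. \<Sum>j=1..<N. F (i, j))"
proof -
  have "{1..N-1} = {1..<N}" by auto
  then show ?thesis by (simp add: Omega_h_def sum.cartesian_product)
qed

lemma finite_Omega_h: "finite (Omega_h N)"
  by (simp add: Omega_h_def)

lemma grid_function_boundary:
  assumes "grid_function N v"
  shows "v (0, j) = 0" "v (N, j) = 0" "v (i, 0) = 0" "v (i, N) = 0"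
  by (rule assms[unfolded grid_function_def, rule_format], force simp: Omega_h_def)+

lemma laplacian_h_symmetric:
  assumes v: "grid_function N v" and w: "grid_function N w"
  shows "(\<Sum>ij\<in>Omega_h N. laplacian_h N v ij * w ij) = (\<Sum>ij\<in>Omega_h N. v ij * laplacian_h N w ij)"
proof -
  note bd = grid_function_boundary[OF v] grid_function_boundary[OF w]
  have "(\<Sum>i=1..<N. \<Sum>j=1..<N. second_diff (\<lambda>k. v (k, j)) i * w (i, j)) =
      (\<Sum>i=1..<N. \<Sum>j=1..<N. v (i, j) * second_diff (\<lambda>k. w (k, j)) i)"
    by (subst (1 2) sum.swap) (intro sum.cong refl second_diff_symmetric[symmetric] bd)
  moreover have "(\<Sum>i=1..<N. \<Sum>j=1..<N. second_diff (\<lambda>l. v (i, l)) j * w (i, j)) =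
      (\<Sum>i=1..<N. \<Sum>j=1..<N. v (i, j) * second_diff (\<lambda>l. w (i, l)) j)"
    by (intro sum.cong refl second_diff_symmetric[symmetric] bd)
  ultimately show ?thesis
    unfolding sum_Omega_h laplacian_h_second_diff
    by (simp add: distrib_left distrib_right sum.distrib sum_distrib_left[symmetric] mult.assoc
        mult.left_commute[of _ "(real N)\<^sup>2"])
qed

text \<open>
  The forward difference in both directions, \<open>h\<^sup>2 D\<^sub>x D\<^sub>y v\<close>.
\<close>

definition mixed_diff :: "(nat \<times> nat \<Rightarrow> real) \<Rightarrow> nat \<Rightarrow> nat \<Rightarrow> real" where
  "mixed_diff v i j = (v (i + 1, j + 1) - v (i, j + 1)) - (v (i + 1, j) - v (i, j))"

text \<open>
  The discrete form of \<open>\<integral> v\<^sub>x\<^sub>x v\<^sub>y\<^sub>y = \<integral> (v\<^sub>x\<^sub>y)\<^sup>2\<close> for functions that vanish on the boundary. Summing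
  by parts in the first direction is possible because the second difference in the other direction
  vanishes on the two sides \<open>i = 0\<close> and \<open>i = N\<close>; differences in different directions commute; and
  \<open>D\<^sub>x v\<close> still vanishes on the sides \<open>j = 0\<close> and \<open>j = N\<close>, which permits the second summation by
  parts.
\<close>

lemma sum_second_diff_product:
  assumes v: "grid_function N v"
  shows "(\<Sum>i=1..<N. \<Sum>j=1..<N. second_diff (\<lambda>k. v (k, j)) i * second_diff (\<lambda>l. v (i, l)) j) =
    (\<Sum>i<N. \<Sum>j<N. (mixed_diff v i j)\<^sup>2)"
proof -
  note bd = grid_function_boundary[OF v]
  define Dx where "Dx i l = v (i + 1, l) - v (i, l)" for i l
  have "(\<Sum>i=1..<N. second_diff (\<lambda>k. v (k, j)) i * second_diff (\<lambda>l. v (i, l)) j) =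
      - (\<Sum>i<N. Dx i j * second_diff (Dx i) j)" for j
  proof -
    have "(\<Sum>i=1..<N. second_diff (\<lambda>l. v (i, l)) j * second_diff (\<lambda>k. v (k, j)) i) =
      - (\<Sum>i<N. (second_diff (\<lambda>l. v (i + 1, l)) j - second_diff (\<lambda>l. v (i, l)) j) *
          (v (i + 1, j) - v (i, j)))"
      by (rule summation_by_parts) (simp_all add: second_diff_def bd)
    also have "\<dots> = - (\<Sum>i<N. Dx i j * second_diff (Dx i) j)"
      by (simp add: Dx_def second_diff_def algebra_simps)
    finally show ?thesis by (simp add: mult.commute)
  qed
  then have "(\<Sum>i=1..<N. \<Sum>j=1..<N. second_diff (\<lambda>k. v (k, j)) i * second_diff (\<lambda>l. v (i, l)) j) =
      - (\<Sum>j=1..<N. \<Sum>i<N. Dx i j * second_diff (Dx i) j)"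
    by (subst sum.swap) (simp add: sum_negf)
  also have "\<dots> = - (\<Sum>i<N. \<Sum>j=1..<N. Dx i j * second_diff (Dx i) j)"
    by (subst sum.swap) simp
  also have "\<dots> = (\<Sum>i<N. \<Sum>j<N. (mixed_diff v i j)\<^sup>2)"
  proof -
    have "- (\<Sum>j=1..<N. Dx i j * second_diff (Dx i) j) = (\<Sum>j<N. (mixed_diff v i j)\<^sup>2)" for i
      by (subst summation_by_parts)
        (simp_all add: Dx_def bd mixed_diff_def power2_eq_square)
    then show ?thesis by (simp add: sum_negf[symmetric])
  qed
  finally show ?thesis .
qed

lemma sum_mixed_diff:
  assumes v: "grid_function N v"
  shows "(\<Sum>k<i. \<Sum>l<j. mixed_diff v k l) = v (i, j)"
proof -
  note bd = grid_function_boundary[OF v]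
  have "(\<Sum>l<j. mixed_diff v k l) = v (k + 1, j) - v (k, j)" for k
    using sum_lessThan_telescope[of "\<lambda>l. v (k + 1, l) - v (k, l)" j]
    by (simp add: mixed_diff_def bd)
  then show ?thesis using sum_lessThan_telescope[of "\<lambda>k. v (k, j)" i] by (simp add: bd)
qed

text \<open>
  By the Cauchy-Schwarz inequality, the representation of \<open>v\<close> as a sum of at most \<open>N\<^sup>2\<close> mixed
  differences bounds \<open>v\<^sup>2\<close> by \<open>N\<^sup>2\<close> times the sum of their squares, and the previous identity together
  with \<open>4 a b \<le> (a + b)\<^sup>2\<close> bounds that sum by the one of \<open>(h\<^sup>2 \<Delta>\<^sub>h v)\<^sup>2 / 4\<close>. The remaining factor \<open>1 / N\<^sup>2\<close> is the
  cell area \<open>h\<^sup>2\<close>, so that the right-hand side is a discrete \<open>L\<^sup>2\<close> norm.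
\<close>

lemma discrete_sobolev:
  assumes v: "grid_function N v" and ij: "ij \<in> Omega_h N"
  shows "(v ij)\<^sup>2 \<le> (\<Sum>kl\<in>Omega_h N. (laplacian_h N v kl)\<^sup>2) / (4 * (real N)\<^sup>2)"
proof -
  obtain i j where [simp]: "ij = (i, j)" by (cases ij)
  have le: "i \<le> N" "j \<le> N" and N: "N > 0" using ij by (auto simp: Omega_h_def)
  define S where "S = (\<Sum>i<N. \<Sum>j<N. (mixed_diff v i j)\<^sup>2)"
  have "(v ij)\<^sup>2 = (\<Sum>kl\<in>{..<i} \<times> {..<j}. 1 * (case kl of (k, l) \<Rightarrow> mixed_diff v k l))\<^sup>2"
    by (simp only: mult_1 \<open>ij = (i, j)\<close> sum.cartesian_product[symmetric] sum_mixed_diff[OF v])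
  also have "\<dots> \<le> (\<Sum>kl\<in>{..<i} \<times> {..<j}. 1\<^sup>2) *
      (\<Sum>kl\<in>{..<i} \<times> {..<j}. (case kl of (k, l) \<Rightarrow> mixed_diff v k l)\<^sup>2)"
    by (rule Cauchy_Schwarz_ineq_sum)
  also have "\<dots> \<le> (real N)\<^sup>2 * (\<Sum>kl\<in>{..<N} \<times> {..<N}. (case kl of (k, l) \<Rightarrow> mixed_diff v k l)\<^sup>2)"
    using le by (intro mult_mono sum_mono2)
      (auto simp: power2_eq_square intro!: mult_mono sum_nonneg simp flip: of_nat_mult)
  also have "(\<Sum>kl\<in>{..<N} \<times> {..<N}. (case kl of (k, l) \<Rightarrow> mixed_diff v k l)\<^sup>2) = S"
    unfolding S_def sum.cartesian_product by (intro sum.cong) auto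
  finally have 1: "(v ij)\<^sup>2 \<le> (real N)\<^sup>2 * S" .
  have "4 * ((real N)\<^sup>2)\<^sup>2 * S = (\<Sum>i=1..<N. \<Sum>j=1..<N.
      4 * ((real N)\<^sup>2)\<^sup>2 * (second_diff (\<lambda>k. v (k, j)) i * second_diff (\<lambda>l. v (i, l)) j))"
    unfolding S_def sum_second_diff_product[OF v, symmetric] by (simp add: sum_distrib_left)
  also have "\<dots> \<le> (\<Sum>i=1..<N. \<Sum>j=1..<N. (laplacian_h N v (i, j))\<^sup>2)"
  proof (intro sum_mono)
    fix i j
    have "4 * c * (a * b) \<le> c * (a + b)\<^sup>2" if "c \<ge> 0" for a b c :: real
    proof -
      have "4 * (a * b) \<le> (a + b)\<^sup>2"
        using zero_le_power2[of "a - b"] by (simp add: power2_eq_square algebra_simps)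
      from mult_left_mono[OF this that] show ?thesis by (simp add: mult_ac)
    qed
    then show "4 * ((real N)\<^sup>2)\<^sup>2 * (second_diff (\<lambda>k. v (k, j)) i * second_diff (\<lambda>l. v (i, l)) j)
        \<le> (laplacian_h N v (i, j))\<^sup>2"
      unfolding laplacian_h_second_diff power_mult_distrib by simp
  qed
  also have "\<dots> = (\<Sum>kl\<in>Omega_h N. (laplacian_h N v kl)\<^sup>2)" by (simp add: sum_Omega_h)
  finally have 2: "4 * ((real N)\<^sup>2)\<^sup>2 * S \<le> (\<Sum>kl\<in>Omega_h N. (laplacian_h N v kl)\<^sup>2)" .
  have "(v ij)\<^sup>2 * (4 * (real N)\<^sup>2) \<le> 4 * ((real N)\<^sup>2)\<^sup>2 * S"
    using mult_right_mono[OF 1, of "4 * (real N)\<^sup>2"] by (simp add: power2_eq_square mult_ac)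
  then show ?thesis using 2 N by (simp add: pos_le_divide_eq)
qed

section \<open>Stability of the scheme\<close>

text \<open>
  Multiplying the first equation by \<open>b\<close>, the second one by \<open>a\<close> and subtracting makes the discrete
  Laplacians cancel after summation, by symmetry. The data terms that remain are absorbed by
  Young's inequality, with weight \<open>\<alpha>\<close> for the product \<open>b r\<close> to match the weight \<open>1 / \<alpha>\<close> of \<open>b\<^sup>2\<close>.
\<close>

lemma energy_estimate:
  assumes al: "\<alpha> > 0" and a: "grid_function N a" and b: "grid_function N b"
    and 1: "\<And>ij. ij \<in> Omega_h N \<Longrightarrow> - laplacian_h N a ij - b ij / \<alpha> = r ij"
    and 2: "\<And>ij. ij \<in> Omega_h N \<Longrightarrow> - laplacian_h N b ij + a ij = s ij"
  shows "(\<Sum>ij\<in>Omega_h N. (a ij)\<^sup>2 + (b ij)\<^sup>2 / \<alpha>) \<le> (\<Sum>ij\<in>Omega_h N. (s ij)\<^sup>2 + \<alpha> * (r ij)\<^sup>2)"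
proof -
  have "(\<Sum>ij\<in>Omega_h N. a ij * s ij - b ij * r ij) =
      (\<Sum>ij\<in>Omega_h N. (a ij)\<^sup>2 + (b ij)\<^sup>2 / \<alpha> + (laplacian_h N a ij * b ij - a ij * laplacian_h N b ij))"
    by (intro sum.cong refl) (simp add: 1[symmetric] 2[symmetric] power2_eq_square algebra_simps)
  then have "(\<Sum>ij\<in>Omega_h N. (a ij)\<^sup>2 + (b ij)\<^sup>2 / \<alpha>) = (\<Sum>ij\<in>Omega_h N. a ij * s ij - b ij * r ij)"
    using laplacian_h_symmetric[OF a b] by (simp add: sum.distrib sum_subtractf)
  also have "\<dots> \<le> (\<Sum>ij\<in>Omega_h N. ((a ij)\<^sup>2 + (b ij)\<^sup>2 / \<alpha>) / 2 + ((s ij)\<^sup>2 + \<alpha> * (r ij)\<^sup>2) / 2)"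
  proof (intro sum_mono)
    fix ij
    have "2 * (a ij * s ij) \<le> (a ij)\<^sup>2 + (s ij)\<^sup>2"
      using zero_le_power2[of "a ij - s ij"] by (simp add: power2_diff)
    moreover have "0 \<le> (b ij + \<alpha> * r ij)\<^sup>2 / \<alpha>" using al by simp
    moreover have "(b ij + \<alpha> * r ij)\<^sup>2 / \<alpha> = (b ij)\<^sup>2 / \<alpha> + \<alpha> * (r ij)\<^sup>2 + 2 * (b ij * r ij)"
      using al by (simp add: field_simps power2_eq_square)
    ultimately show "a ij * s ij - b ij * r ij
        \<le> ((a ij)\<^sup>2 + (b ij)\<^sup>2 / \<alpha>) / 2 + ((s ij)\<^sup>2 + \<alpha> * (r ij)\<^sup>2) / 2"
      by argo
  qed
  finally show ?thesis
    by (simp only: sum.distrib sum_divide_distrib[symmetric]) argo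
qed

text \<open>
  The constant depends on \<open>\<alpha>\<close> only: the grid has fewer than \<open>N\<^sup>2\<close> points, which the factor
  \<open>h\<^sup>2 = 1 / N\<^sup>2\<close> in \<open>discrete_sobolev\<close> compensates.
\<close>

lemma stability:
  assumes al: "\<alpha> > 0" and a: "grid_function N a" and b: "grid_function N b"
    and 1: "\<And>ij. ij \<in> Omega_h N \<Longrightarrow> \<bar>- laplacian_h N a ij - b ij / \<alpha>\<bar> \<le> K"
    and 2: "\<And>ij. ij \<in> Omega_h N \<Longrightarrow> \<bar>- laplacian_h N b ij + a ij\<bar> \<le> K"
    and ij: "ij \<in> Omega_h N"
  shows "\<bar>a ij\<bar> \<le> sqrt (2 + \<alpha> + 1 / \<alpha>) * K" "\<bar>b ij\<bar> \<le> sqrt (2 + \<alpha> + 1 / \<alpha>) * K"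
proof -
  have N: "N > 0" using ij by (auto simp: Omega_h_def)
  have K: "K \<ge> 0" using 1[OF ij] by linarith
  define r where "r ij = - laplacian_h N a ij - b ij / \<alpha>" for ij
  define s where "s ij = - laplacian_h N b ij + a ij" for ij
  define A where "A = (\<Sum>ij\<in>Omega_h N. (a ij)\<^sup>2)"
  define B where "B = (\<Sum>ij\<in>Omega_h N. (b ij)\<^sup>2)"
  have AB0: "A \<ge> 0" "B \<ge> 0" by (auto simp: A_def B_def sum_nonneg)
  have card: "real (card (Omega_h N)) \<le> (real N)\<^sup>2"
  proof -
    have "card (Omega_h N) \<le> N * N" by (simp add: Omega_h_def mult_mono)
    then show ?thesis by (metis of_nat_le_iff of_nat_power power2_eq_square)
  qed
  \<comment> \<open>\<open>Q\<close> bounds the sum of squares of any grid function bounded by \<open>K\<close>.\<close>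
  define Q where "Q = (real N)\<^sup>2 * K\<^sup>2"
  have sq: "(\<Sum>ij\<in>Omega_h N. (w ij)\<^sup>2) \<le> Q"
    if "\<And>ij. ij \<in> Omega_h N \<Longrightarrow> \<bar>w ij\<bar> \<le> K" for w :: "nat \<times> nat \<Rightarrow> real"
  proof -
    have "(\<Sum>ij\<in>Omega_h N. (w ij)\<^sup>2) \<le> (\<Sum>ij\<in>Omega_h N. K\<^sup>2)"
      using that by (intro sum_mono) (metis abs_ge_zero power2_abs power_mono)
    also have "\<dots> \<le> Q" using card by (simp add: Q_def mult_right_mono)
    finally show ?thesis .
  qed
  have R: "(\<Sum>ij\<in>Omega_h N. (r ij)\<^sup>2) \<le> Q" and S: "(\<Sum>ij\<in>Omega_h N. (s ij)\<^sup>2) \<le> Q"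
    using 1 2 by (auto intro!: sq simp: r_def s_def)
  have "A + B / \<alpha> \<le> (\<Sum>ij\<in>Omega_h N. (s ij)\<^sup>2) + \<alpha> * (\<Sum>ij\<in>Omega_h N. (r ij)\<^sup>2)"
    using energy_estimate[OF al a b, of r s]
    by (simp add: r_def s_def A_def B_def sum.distrib sum_divide_distrib sum_distrib_left)
  also have "\<dots> \<le> Q + \<alpha> * Q" using R S al by (intro add_mono mult_left_mono) auto
  finally have E: "A + B / \<alpha> \<le> Q + \<alpha> * Q" .
  \<comment> \<open>The equations express \<open>\<Delta>\<^sub>h v\<close>, for \<open>v\<close> either \<open>a\<close> or \<open>b\<close>, as a residual \<open>c\<close> plus a
     multiple \<open>d\<close> of the other unknown, which the energy estimate controls.\<close>
  have sup: "\<bar>v ij\<bar> \<le> sqrt (2 + \<alpha> + 1 / \<alpha>) * K"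
    if v: "grid_function N v" and w: "\<And>ij. ij \<in> Omega_h N \<Longrightarrow> laplacian_h N v ij = c ij + d ij"
      and c: "(\<Sum>ij\<in>Omega_h N. (c ij)\<^sup>2) \<le> Q"
      and d: "(\<Sum>ij\<in>Omega_h N. (d ij)\<^sup>2) \<le> (1 + \<alpha> + 1 / \<alpha>) * Q" for v c d
  proof -
    have "(\<Sum>ij\<in>Omega_h N. (laplacian_h N v ij)\<^sup>2) \<le> (\<Sum>ij\<in>Omega_h N. 2 * (c ij)\<^sup>2 + 2 * (d ij)\<^sup>2)"
    proof (intro sum_mono)
      fix ij assume "ij \<in> Omega_h N"
      then show "(laplacian_h N v ij)\<^sup>2 \<le> 2 * (c ij)\<^sup>2 + 2 * (d ij)\<^sup>2"
        using zero_le_power2[of "c ij - d ij"] by (simp add: w power2_diff power2_sum)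
    qed
    also have "\<dots> \<le> 2 * Q + 2 * ((1 + \<alpha> + 1 / \<alpha>) * Q)"
      using c d by (simp add: sum.distrib sum_distrib_left[symmetric])
    also have "\<dots> = 2 * ((2 + \<alpha> + 1 / \<alpha>) * Q)" by (simp add: algebra_simps)
    also have "\<dots> \<le> 4 * ((2 + \<alpha> + 1 / \<alpha>) * Q)"
      using al by (simp add: Q_def)
    finally have "(v ij)\<^sup>2 \<le> 4 * ((2 + \<alpha> + 1 / \<alpha>) * Q) / (4 * (real N)\<^sup>2)"
      using discrete_sobolev[OF v ij] divide_right_mono[of _ _ "4 * (real N)\<^sup>2"] by force
    also have "\<dots> = (2 + \<alpha> + 1 / \<alpha>) * K\<^sup>2" using N by (simp add: Q_def)
    finally have "sqrt ((v ij)\<^sup>2) \<le> sqrt ((2 + \<alpha> + 1 / \<alpha>) * K\<^sup>2)" by (rule real_sqrt_le_mono)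
    then show ?thesis using K by (simp add: real_sqrt_mult)
  qed
  have Q: "Q \<ge> 0" by (simp add: Q_def)
  show "\<bar>a ij\<bar> \<le> sqrt (2 + \<alpha> + 1 / \<alpha>) * K"
  proof (rule sup[OF a, of "\<lambda>ij. - r ij" "\<lambda>ij. - b ij / \<alpha>"])
    have "B / \<alpha> \<le> Q + \<alpha> * Q" using E AB0 by linarith
    then have "B / \<alpha> / \<alpha> \<le> (Q + \<alpha> * Q) / \<alpha>" using al by (intro divide_right_mono) auto
    also have "\<dots> \<le> (1 + \<alpha> + 1 / \<alpha>) * Q" using al Q by (simp add: field_simps)
    finally show "(\<Sum>ij\<in>Omega_h N. (- b ij / \<alpha>)\<^sup>2) \<le> (1 + \<alpha> + 1 / \<alpha>) * Q"
      by (simp add: B_def power_divide power2_eq_square[of \<alpha>] sum_divide_distrib)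
    show "(\<Sum>ij\<in>Omega_h N. (- r ij)\<^sup>2) \<le> Q" using R by simp
  qed (simp add: r_def)
  show "\<bar>b ij\<bar> \<le> sqrt (2 + \<alpha> + 1 / \<alpha>) * K"
  proof (rule sup[OF b, of "\<lambda>ij. - s ij" a])
    have "A \<le> Q + \<alpha> * Q" using E AB0 al by (smt (verit) divide_nonneg_pos)
    also have "\<dots> \<le> (1 + \<alpha> + 1 / \<alpha>) * Q" using al Q by (simp add: field_simps)
    finally show "(\<Sum>ij\<in>Omega_h N. (a ij)\<^sup>2) \<le> (1 + \<alpha> + 1 / \<alpha>) * Q" by (simp add: A_def)
    show "(\<Sum>ij\<in>Omega_h N. (- s ij)\<^sup>2) \<le> Q" using S by simp
  qed (simp add: s_def)
qed

lemma laplacian_h_linear: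
  "laplacian_h N (\<lambda>ij. v ij + w ij) ij = laplacian_h N v ij + laplacian_h N w ij"
  "laplacian_h N (\<lambda>ij. v ij - w ij) ij = laplacian_h N v ij - laplacian_h N w ij"
  "laplacian_h N (\<lambda>ij. c * v ij) ij = c * laplacian_h N v ij"
  by (cases ij; simp add: laplacian_h_second_diff second_diff_def algebra_simps)+

text \<open>
  Grid functions that satisfy the scheme up to residuals of size \<open>K\<close> are close to its solution. This
  serves twice: for the restriction of the exact solution, where \<open>K = O(h\<^sup>2)\<close>, and for a second
  discrete solution, where \<open>K = 0\<close>.
\<close>

lemma fd_scheme_difference:
  assumes al: "\<alpha> > 0" and s: "fd_scheme \<alpha> f g N z\<^sub>h u\<^sub>h p\<^sub>h"
    and Z: "grid_function N Z" and P: "grid_function N P"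
    and 1: "\<And>ij. ij \<in> Omega_h N \<Longrightarrow> \<bar>- laplacian_h N Z ij - P ij / \<alpha> - f (grid_point N ij)\<bar> \<le> K"
    and 2: "\<And>ij. ij \<in> Omega_h N \<Longrightarrow> \<bar>- laplacian_h N P ij + Z ij - g (grid_point N ij)\<bar> \<le> K"
    and ij: "ij \<in> Omega_h N"
  shows "\<bar>Z ij - z\<^sub>h ij\<bar> \<le> sqrt (2 + \<alpha> + 1 / \<alpha>) * K" "\<bar>P ij - p\<^sub>h ij\<bar> \<le> sqrt (2 + \<alpha> + 1 / \<alpha>) * K"
proof -
  have gf: "grid_function N (\<lambda>ij. Z ij - z\<^sub>h ij)" "grid_function N (\<lambda>ij. P ij - p\<^sub>h ij)"
    using Z P s by (auto simp: fd_scheme_def grid_function_def)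
  have "u\<^sub>h ij = p\<^sub>h ij / \<alpha>" if "ij \<in> Omega_h N" for ij
    using s al that by (auto simp: fd_scheme_def field_simps)
  then have f: "f (grid_point N ij) = - laplacian_h N z\<^sub>h ij - p\<^sub>h ij / \<alpha>"
    and g: "g (grid_point N ij) = - laplacian_h N p\<^sub>h ij + z\<^sub>h ij" if "ij \<in> Omega_h N" for ij
    using s that by (auto simp: fd_scheme_def)
  have e1: "\<bar>- laplacian_h N (\<lambda>ij. Z ij - z\<^sub>h ij) ij - (P ij - p\<^sub>h ij) / \<alpha>\<bar> \<le> K"
    if "ij \<in> Omega_h N" for ij
    using 1[OF that] by (simp add: f[OF that] laplacian_h_linear diff_divide_distrib algebra_simps)
  have e2: "\<bar>- laplacian_h N (\<lambda>ij. P ij - p\<^sub>h ij) ij + (Z ij - z\<^sub>h ij)\<bar> \<le> K"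
    if "ij \<in> Omega_h N" for ij
    using 2[OF that] by (simp add: g[OF that] laplacian_h_linear algebra_simps)
  from stability[OF al gf, OF e1 e2 ij]
  show "\<bar>Z ij - z\<^sub>h ij\<bar> \<le> sqrt (2 + \<alpha> + 1 / \<alpha>) * K" "\<bar>P ij - p\<^sub>h ij\<bar> \<le> sqrt (2 + \<alpha> + 1 / \<alpha>) * K"
    by auto
qed

lemma fd_scheme_unique:
  assumes al: "\<alpha> > 0" and s: "fd_scheme \<alpha> f g N z\<^sub>h u\<^sub>h p\<^sub>h" and s': "fd_scheme \<alpha> f g N z' u' p'"
  shows "z\<^sub>h = z' \<and> u\<^sub>h = u' \<and> p\<^sub>h = p'"
proof -
  have u: "u' ij = p' ij / \<alpha>" "u\<^sub>h ij = p\<^sub>h ij / \<alpha>" if "ij \<in> Omega_h N" for ij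
    using s s' al that by (auto simp: fd_scheme_def field_simps)
  have gf: "grid_function N z'" "grid_function N p'" using s' by (auto simp: fd_scheme_def)
  have "z\<^sub>h ij = z' ij \<and> p\<^sub>h ij = p' ij" if "ij \<in> Omega_h N" for ij
    using fd_scheme_difference[OF al s gf, where K=0, OF _ _ that] s' u
    by (simp add: fd_scheme_def)
  moreover have "z\<^sub>h ij = z' ij \<and> u\<^sub>h ij = u' ij \<and> p\<^sub>h ij = p' ij" if "ij \<notin> Omega_h N" for ij
    using s s' that unfolding fd_scheme_def grid_function_def by metis
  ultimately have "z\<^sub>h ij = z' ij \<and> u\<^sub>h ij = u' ij \<and> p\<^sub>h ij = p' ij" for ij
    using u by metis
  then show ?thesis by auto
qed

text \<open>
  The control is eliminated by \<open>u = p / \<alpha>\<close>. The remaining unknowns form one vector indexed by a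
  disjoint sum, with \<open>Inl\<close> for the state and \<open>Inr\<close> for the adjoint state, and likewise for the two
  equations; injectivity of the system is the stability estimate with \<open>K = 0\<close>.
\<close>

lemma fd_scheme_exists:
  assumes al: "\<alpha> > 0"
  shows "\<exists>z\<^sub>h u\<^sub>h p\<^sub>h. fd_scheme \<alpha> f g N z\<^sub>h u\<^sub>h p\<^sub>h"
proof -
  define T :: "(nat \<times> nat + nat \<times> nat \<Rightarrow> real) \<Rightarrow> nat \<times> nat + nat \<times> nat \<Rightarrow> real" where
    "T x j = (case j of
        Inl ij \<Rightarrow> - laplacian_h N (\<lambda>kl. x (Inl kl)) ij - x (Inr ij) / \<alpha>
      | Inr ij \<Rightarrow> - laplacian_h N (\<lambda>kl. x (Inr kl)) ij + x (Inl ij))" for x j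
  let ?I = "Omega_h N <+> Omega_h N"
  have "\<exists>x. (\<forall>i. i \<notin> ?I \<longrightarrow> x i = 0) \<and>
      (\<forall>j\<in>?I. T x j = (case j of Inl ij \<Rightarrow> f (grid_point N ij) | Inr ij \<Rightarrow> g (grid_point N ij)))"
  proof (rule injective_linear_map_surjective)
    fix x assume supp: "\<forall>i. i \<notin> ?I \<longrightarrow> x i = 0" and zero: "\<forall>j\<in>?I. T x j = 0"
    have gf: "grid_function N (\<lambda>ij. x (Inl ij))" "grid_function N (\<lambda>ij. x (Inr ij))"
      using supp by (auto simp: grid_function_def)
    have eqs: "- laplacian_h N (\<lambda>kl. x (Inl kl)) ij - x (Inr ij) / \<alpha> = 0"
      "- laplacian_h N (\<lambda>kl. x (Inr kl)) ij + x (Inl ij) = 0" if "ij \<in> Omega_h N" for ij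
      using zero that by (auto simp: T_def ball_Un Plus_def)
    have "x (Inl ij) = 0" "x (Inr ij) = 0" if "ij \<in> Omega_h N" for ij
      using stability[OF al gf, where K=0, OF _ _ that] eqs by simp_all
    then show "\<forall>i\<in>?I. x i = 0" by auto
  qed (auto simp: T_def finite_Omega_h laplacian_h_linear add_divide_distrib algebra_simps
        split: sum.splits)
  then obtain x where supp: "\<forall>i. i \<notin> ?I \<longrightarrow> x i = 0"
    and x: "\<forall>j\<in>?I. T x j = (case j of Inl ij \<Rightarrow> f (grid_point N ij) | Inr ij \<Rightarrow> g (grid_point N ij))"
    by blast
  have "- laplacian_h N (\<lambda>kl. x (Inl kl)) ij - x (Inr ij) / \<alpha> = f (grid_point N ij)"
    "- laplacian_h N (\<lambda>kl. x (Inr kl)) ij + x (Inl ij) = g (grid_point N ij)"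
    if "ij \<in> Omega_h N" for ij
    using x that by (auto simp: T_def ball_Un Plus_def)
  moreover have "grid_function N (\<lambda>ij. x (Inl ij))" "grid_function N (\<lambda>ij. x (Inr ij))"
    using supp by (auto simp: grid_function_def)
  ultimately have "fd_scheme \<alpha> f g N (\<lambda>ij. x (Inl ij)) (\<lambda>ij. x (Inr ij) / \<alpha>) (\<lambda>ij. x (Inr ij))"
    using al by (auto simp: fd_scheme_def grid_function_def)
  then show ?thesis by blast
qed

section \<open>Consistency of the five-point stencil\<close>

text \<open>
  A direct consequence of the mean value theorem. It replaces Taylor's formula because it only asks
  for continuity at the end points: the interval may reach the boundary of the domain, where the
  derivatives exist only as continuous extensions.
\<close>

lemma abs_le_power_Suc_of_derivative:
  fixes G G' :: "real \<Rightarrow> real"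
  assumes cont: "continuous_on {0..h} G" and 0: "G 0 = 0"
    and der: "\<And>t. 0 < t \<Longrightarrow> t < h \<Longrightarrow> (G has_real_derivative G' t) (at t)"
    and bd: "\<And>t. 0 < t \<Longrightarrow> t < h \<Longrightarrow> \<bar>G' t\<bar> \<le> K * t ^ n"
    and K: "K \<ge> 0" and t: "0 \<le> t" "t \<le> h"
  shows "\<bar>G t\<bar> \<le> K * t ^ Suc n"
proof (cases "t = 0")
  case False
  then have "0 < t" using t by simp
  moreover have "continuous_on {0..t} G" using cont t by (auto intro: continuous_on_subset)
  moreover have "G differentiable (at s)" if "0 < s" "s < t" for s
    using der[of s] that t by (force simp: real_differentiable_def)
  ultimately obtain l s where s: "0 < s" "s < t" "(G has_real_derivative l) (at s)"
    "G t - G 0 = (t - 0) * l" using MVT[of 0 t G] by blast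
  then have "l = G' s" using der[of s] t DERIV_unique by force
  then have "\<bar>l\<bar> \<le> K * s ^ n" using bd s t by simp
  also have "\<dots> \<le> K * t ^ n" using K s by (intro mult_left_mono power_mono) auto
  finally have "t * \<bar>l\<bar> \<le> t * (K * t ^ n)" using t by (intro mult_left_mono) auto
  then show ?thesis using s 0 t by (simp add: abs_mult mult_ac)
qed (simp add: 0)

text \<open>
  The error, as a function of the step \<open>t\<close>, vanishes at \<open>t = 0\<close> together with its first three
  derivatives, and its fourth derivative \<open>d 4 (x + t) + d 4 (x - t)\<close> is bounded by \<open>2 M\<close>. Each of
  four steps from a derivative back to its antiderivative gains one power of the step.
\<close>

lemma central_difference_error:
  fixes d :: "nat \<Rightarrow> real \<Rightarrow> real"
  assumes h: "h > 0"
    and cont: "\<And>m. m < 4 \<Longrightarrow> continuous_on {x-h..x+h} (d m)"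
    and der: "\<And>m s. m < 4 \<Longrightarrow> s \<in> {x-h<..<x+h} \<Longrightarrow> (d m has_real_derivative d (Suc m) s) (at s)"
    and bd: "\<And>s. s \<in> {x-h<..<x+h} \<Longrightarrow> \<bar>d 4 s\<bar> \<le> M"
  shows "\<bar>d 0 (x + h) + d 0 (x - h) - 2 * d 0 x - h\<^sup>2 * d 2 x\<bar> \<le> 2 * M * h ^ 4"
proof -
  have M: "0 \<le> 2 * M" using bd[of x] h by simp
  have c[continuous_intros]: "continuous_on {0..h} (\<lambda>t. d m (x + t))"
    "continuous_on {0..h} (\<lambda>t. d m (x - t))" if "m < 4" for m
    using that h by (auto intro!: continuous_on_compose2[OF cont] continuous_intros)
  have D[derivative_intros]: "((\<lambda>t. d m (x + t)) has_real_derivative d (Suc m) (x + t)) (at t)"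
    "((\<lambda>t. d m (x - t)) has_real_derivative - d (Suc m) (x - t)) (at t)"
    if "m < 4" "0 < t" "t < h" for m t
  proof -
    have "((\<lambda>t. d m (x + t)) has_real_derivative d (Suc m) (x + t) * 1) (at t)"
      by (rule DERIV_chain2[OF der]) (use that in \<open>auto intro!: derivative_eq_intros\<close>)
    then show "((\<lambda>t. d m (x + t)) has_real_derivative d (Suc m) (x + t)) (at t)" by simp
    have "((\<lambda>t. d m (x - t)) has_real_derivative d (Suc m) (x - t) * (-1)) (at t)"
      by (rule DERIV_chain2[OF der]) (use that in \<open>auto intro!: derivative_eq_intros\<close>)
    then show "((\<lambda>t. d m (x - t)) has_real_derivative - d (Suc m) (x - t)) (at t)" by simp
  qed
  have F4: "\<bar>d 4 (x + t) + d 4 (x - t)\<bar> \<le> 2 * M * t ^ 0" if "0 < t" "t < h" for t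
    using bd[of "x + t"] bd[of "x - t"] that by simp
  have F3: "\<bar>d 3 (x + t) - d 3 (x - t)\<bar> \<le> 2 * M * t ^ Suc 0" if "0 \<le> t" "t \<le> h" for t
    by (rule abs_le_power_Suc_of_derivative[where G = "\<lambda>t. d 3 (x + t) - d 3 (x - t)", OF _ _ _ F4 M that])
      (auto intro!: continuous_intros derivative_eq_intros simp: eval_nat_numeral)
  have F2: "\<bar>d 2 (x + t) + d 2 (x - t) - 2 * d 2 x\<bar> \<le> 2 * M * t ^ Suc (Suc 0)"
    if "0 \<le> t" "t \<le> h" for t
    by (rule abs_le_power_Suc_of_derivative[where G = "\<lambda>t. d 2 (x + t) + d 2 (x - t) - 2 * d 2 x",
            OF _ _ _ F3 M that])
      (auto intro!: continuous_intros derivative_eq_intros simp: eval_nat_numeral)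
  have F1: "\<bar>d 1 (x + t) - d 1 (x - t) - 2 * t * d 2 x\<bar> \<le> 2 * M * t ^ Suc (Suc (Suc 0))"
    if "0 \<le> t" "t \<le> h" for t
    by (rule abs_le_power_Suc_of_derivative[where G = "\<lambda>t. d 1 (x + t) - d 1 (x - t) - 2 * t * d 2 x",
            OF _ _ _ F2 M that])
      (auto intro!: continuous_intros derivative_eq_intros simp: eval_nat_numeral)
  have "\<bar>d 0 (x + t) + d 0 (x - t) - 2 * d 0 x - t\<^sup>2 * d 2 x\<bar> \<le> 2 * M * t ^ Suc (Suc (Suc (Suc 0)))"
    if "0 \<le> t" "t \<le> h" for t
    by (rule abs_le_power_Suc_of_derivative[
            where G = "\<lambda>t. d 0 (x + t) + d 0 (x - t) - 2 * d 0 x - t\<^sup>2 * d 2 x", OF _ _ _ F1 M that])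
      (auto intro!: continuous_intros derivative_eq_intros)
  from this[of h] show ?thesis using h by (simp add: eval_nat_numeral)
qed

text \<open>
  The stencil involves no mixed derivatives, so of the tree of partial derivatives provided by
  \<open>Ck_closure\<close> only two branches are kept: \<open>d m\<close> is the \<open>m\<close>-th derivative in the first variable and
  \<open>e m\<close> the one in the second.
\<close>

lemma Ck_closure_pure_derivatives:
  assumes "Ck_closure k U v"
  shows "\<exists>d e :: nat \<Rightarrow> real \<times> real \<Rightarrow> real. d 0 = v \<and> e 0 = v \<and>
    (\<forall>m\<le>k. continuous_on (closure U) (d m) \<and> continuous_on (closure U) (e m)) \<and>
    (\<forall>m<k. \<forall>x y. (x, y) \<in> U \<longrightarrow>
       ((\<lambda>s. d m (s, y)) has_real_derivative d (Suc m) (x, y)) (at x) \<and>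
       ((\<lambda>t. e m (x, t)) has_real_derivative e (Suc m) (x, y)) (at y))"
  using assms
proof (induction k arbitrary: v)
  case 0
  then show ?case by (intro exI[of _ "\<lambda>_. v"]) simp
next
  case (Suc k)
  then obtain vx vy where v: "continuous_on (closure U) v" "Ck_closure k U vx" "Ck_closure k U vy"
    and der: "\<And>x y. (x, y) \<in> U \<Longrightarrow>
          ((\<lambda>s. v (s, y)) has_real_derivative vx (x, y)) (at x) \<and>
          ((\<lambda>t. v (x, t)) has_real_derivative vy (x, y)) (at y)" by auto
  from Suc.IH[OF v(2)] obtain d where d: "d 0 = vx" "\<forall>m\<le>k. continuous_on (closure U) (d m)"
    "\<forall>m<k. \<forall>x y. (x, y) \<in> U \<longrightarrow> ((\<lambda>s. d m (s, y)) has_real_derivative d (Suc m) (x, y)) (at x)"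
    by blast
  from Suc.IH[OF v(3)] obtain e where e: "e 0 = vy" "\<forall>m\<le>k. continuous_on (closure U) (e m)"
    "\<forall>m<k. \<forall>x y. (x, y) \<in> U \<longrightarrow> ((\<lambda>t. e m (x, t)) has_real_derivative e (Suc m) (x, y)) (at y)"
    by blast
  show ?case
    by (intro exI[of _ "case_nat v d"] exI[of _ "case_nat v e"])
      (use v(1) der d e in \<open>auto split: nat.splits\<close>)
qed

lemma closure_Omega: "closure Omega = {0..1} \<times> {0..1}"
  by (simp add: Omega_def closure_Times)

lemma frontier_Omega: "frontier Omega = {0..1} \<times> {0..1} - Omega"
proof -
  have "open Omega" by (simp add: Omega_def open_Times)
  then show ?thesis by (simp add: frontier_def interior_open closure_Omega)
qed

lemma grid_point_in_Omega:
  assumes "ij \<in> Omega_h N" shows "grid_point N ij \<in> Omega"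
  using assms by (auto simp: Omega_h_def grid_point_def Omega_def field_simps)

lemma deriv_deriv_eq:
  fixes v v' :: "real \<Rightarrow> real"
  assumes "open S" "x \<in> S"
    and "\<And>s. s \<in> S \<Longrightarrow> (v has_real_derivative v' s) (at s)"
    and "(v' has_real_derivative c) (at x)"
  shows "deriv (deriv v) x = c"
proof -
  have "\<forall>\<^sub>F s in nhds x. deriv v s = v' s"
    using assms by (auto simp: eventually_nhds intro!: exI[of _ S] DERIV_imp_deriv)
  then have "deriv (deriv v) x = deriv v' x" by (rule deriv_cong_ev) simp
  then show ?thesis using assms(4) by (simp add: DERIV_imp_deriv)
qed

lemma five_point_stencil_consistent:
  assumes "Ck_closure 4 Omega v"
  shows "\<exists>C. \<forall>N. \<forall>ij\<in>Omega_h N.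
    \<bar>laplacian v (grid_point N ij) - laplacian_h N (\<lambda>kl. v (grid_point N kl)) ij\<bar> \<le> C * (1 / real N)\<^sup>2"
proof -
  obtain d e :: "nat \<Rightarrow> real \<times> real \<Rightarrow> real" where v: "d 0 = v" "e 0 = v"
    and cont: "\<And>m. m \<le> 4 \<Longrightarrow> continuous_on (closure Omega) (d m)"
      "\<And>m. m \<le> 4 \<Longrightarrow> continuous_on (closure Omega) (e m)"
    and der: "\<And>m x y. m < 4 \<Longrightarrow> (x, y) \<in> Omega \<Longrightarrow>
        ((\<lambda>s. d m (s, y)) has_real_derivative d (Suc m) (x, y)) (at x)"
      "\<And>m x y. m < 4 \<Longrightarrow> (x, y) \<in> Omega \<Longrightarrow>
        ((\<lambda>t. e m (x, t)) has_real_derivative e (Suc m) (x, y)) (at y)"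
    using Ck_closure_pure_derivatives[OF assms] by blast
  have "compact (closure Omega)" by (simp add: closure_Omega compact_Times)
  then have "bounded (d 4 ` closure Omega)" "bounded (e 4 ` closure Omega)"
    using cont by (auto intro!: compact_imp_bounded compact_continuous_image)
  then obtain Md Me where "\<And>q. q \<in> closure Omega \<Longrightarrow> \<bar>d 4 q\<bar> \<le> Md"
    "\<And>q. q \<in> closure Omega \<Longrightarrow> \<bar>e 4 q\<bar> \<le> Me" by (auto simp: bounded_iff)
  then obtain M where M: "\<And>q. q \<in> closure Omega \<Longrightarrow> \<bar>d 4 q\<bar> \<le> M \<and> \<bar>e 4 q\<bar> \<le> M"
    by (metis max.coboundedI1 max.coboundedI2)
  have "\<bar>laplacian v (grid_point N ij) - laplacian_h N (\<lambda>kl. v (grid_point N kl)) ij\<bar>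
      \<le> 4 * M * (1 / real N)\<^sup>2" if ij: "ij \<in> Omega_h N" for N ij
  proof -
    obtain i j where [simp]: "ij = (i, j)" by (cases ij)
    define h where "h = 1 / real N"
    define x where "x = real i / real N"
    define y where "y = real j / real N"
    have N: "N > 0" "1 \<le> i" "i \<le> N - 1" "1 \<le> j" "j \<le> N - 1"
      using ij by (auto simp: Omega_h_def)
    have h: "h > 0" and xy: "0 \<le> x - h" "x + h \<le> 1" "0 \<le> y - h" "y + h \<le> 1"
      using N by (auto simp: h_def x_def y_def field_simps)
    have xy_Omega: "(x, y) \<in> Omega" using xy h by (simp add: Omega_def)
    have gp: "grid_point N (i, j) = (x, y)"
      "grid_point N (i + 1, j) = (x + h, y)" "grid_point N (i - 1, j) = (x - h, y)"
      "grid_point N (i, j + 1) = (x, y + h)" "grid_point N (i, j - 1) = (x, y - h)"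
      using N by (auto simp: grid_point_def x_def y_def h_def add_divide_distrib diff_divide_distrib
          of_nat_diff)
    have X: "\<bar>v (x + h, y) + v (x - h, y) - 2 * v (x, y) - h\<^sup>2 * d 2 (x, y)\<bar> \<le> 2 * M * h ^ 4"
    proof (rule central_difference_error[of h x "\<lambda>m s. d m (s, y)", simplified v, OF h])
      show "continuous_on {x-h..x+h} (\<lambda>s. d m (s, y))" if "m < 4" for m
        using that xy h
        by (auto intro!: continuous_on_compose2[OF cont(1)] continuous_intros simp: closure_Omega)
      show "((\<lambda>s. d m (s, y)) has_real_derivative d (Suc m) (s, y)) (at s)"
        if "m < 4" "s \<in> {x-h<..<x+h}" for m s
        using that xy h by (auto intro!: der simp: Omega_def)
      show "\<bar>d 4 (s, y)\<bar> \<le> M" if "s \<in> {x-h<..<x+h}" for s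
        using that xy h M[of "(s, y)"] by (auto simp: closure_Omega)
    qed
    have Y: "\<bar>v (x, y + h) + v (x, y - h) - 2 * v (x, y) - h\<^sup>2 * e 2 (x, y)\<bar> \<le> 2 * M * h ^ 4"
    proof (rule central_difference_error[of h y "\<lambda>m t. e m (x, t)", simplified v, OF h])
      show "continuous_on {y-h..y+h} (\<lambda>t. e m (x, t))" if "m < 4" for m
        using that xy h
        by (auto intro!: continuous_on_compose2[OF cont(2)] continuous_intros simp: closure_Omega)
      show "((\<lambda>t. e m (x, t)) has_real_derivative e (Suc m) (x, s)) (at s)"
        if "m < 4" "s \<in> {y-h<..<y+h}" for m s
        using that xy h by (auto intro!: der simp: Omega_def)
      show "\<bar>e 4 (x, s)\<bar> \<le> M" if "s \<in> {y-h<..<y+h}" for s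
        using that xy h M[of "(x, s)"] by (auto simp: closure_Omega)
    qed
    have "deriv (deriv (\<lambda>s. v (s, y))) x = d 2 (x, y)"
      using der(1)[of 0] der(1)[of 1 x y] xy_Omega
      by (intro deriv_deriv_eq[where S = "{0<..<1}" and v' = "\<lambda>s. d 1 (s, y)"])
        (auto simp: Omega_def v numeral_2_eq_2)
    moreover have "deriv (deriv (\<lambda>t. v (x, t))) y = e 2 (x, y)"
      using der(2)[of 0] der(2)[of 1 x y] xy_Omega
      by (intro deriv_deriv_eq[where S = "{0<..<1}" and v' = "\<lambda>t. e 1 (x, t)"])
        (auto simp: Omega_def v numeral_2_eq_2)
    ultimately have lap: "laplacian v (x, y) = d 2 (x, y) + e 2 (x, y)"
      by (simp add: laplacian_def)
    let ?S = "v (x + h, y) + v (x - h, y) + v (x, y + h) + v (x, y - h) - 4 * v (x, y)"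
    have "laplacian_h N (\<lambda>kl. v (grid_point N kl)) ij = ?S / h\<^sup>2"
      by (simp only: laplacian_h_def gp \<open>ij = (i, j)\<close> prod.case h_def[symmetric])
    moreover have "\<bar>laplacian v (x, y) - ?S / h\<^sup>2\<bar> = \<bar>h\<^sup>2 * laplacian v (x, y) - ?S\<bar> / h\<^sup>2"
    proof -
      have "laplacian v (x, y) - ?S / h\<^sup>2 = (h\<^sup>2 * laplacian v (x, y) - ?S) / h\<^sup>2"
        using h by (simp add: diff_divide_distrib)
      then show ?thesis using h by (simp add: abs_divide)
    qed
    moreover have "\<bar>h\<^sup>2 * laplacian v (x, y) - ?S\<bar> \<le> 4 * M * h ^ 4"
      using X Y by (simp add: lap algebra_simps)
    then have "\<bar>h\<^sup>2 * laplacian v (x, y) - ?S\<bar> / h\<^sup>2 \<le> 4 * M * h\<^sup>2"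
      using h by (simp add: pos_divide_le_eq power4_eq_xxxx power2_eq_square mult_ac)
    ultimately show ?thesis by (simp add: gp h_def)
  qed
  then show ?thesis by blast
qed

section \<open>Convergence\<close>

text \<open>
  Extension by zero agrees with sampling at the boundary nodes when the function vanishes on the
  boundary; this is where the boundary conditions enter.
\<close>

definition grid_restriction :: "nat \<Rightarrow> (real \<times> real \<Rightarrow> real) \<Rightarrow> nat \<times> nat \<Rightarrow> real" where
  "grid_restriction N v = (\<lambda>ij. if ij \<in> Omega_h N then v (grid_point N ij) else 0)"

lemma laplacian_h_grid_restriction:
  assumes bd: "\<forall>x\<in>frontier Omega. v x = 0" and ij: "ij \<in> Omega_h N"
  shows "laplacian_h N (grid_restriction N v) ij = laplacian_h N (\<lambda>kl. v (grid_point N kl)) ij"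
proof -
  have r: "grid_restriction N v (k, l) = v (grid_point N (k, l))" if "k \<le> N" "l \<le> N" for k l
  proof (cases "(k, l) \<in> Omega_h N")
    case False
    have "grid_point N (k, l) \<in> {0..1} \<times> {0..1} - Omega" if "N > 0"
      using False \<open>k \<le> N\<close> \<open>l \<le> N\<close> that
      by (auto simp: Omega_h_def grid_point_def Omega_def field_simps)
    moreover have "N > 0" using ij by (auto simp: Omega_h_def)
    ultimately show ?thesis using bd False by (simp add: grid_restriction_def frontier_Omega)
  qed (simp add: grid_restriction_def)
  obtain i j where "ij = (i, j)" by (cases ij)
  then show ?thesis using ij r by (auto simp: laplacian_h_def Omega_h_def)
qed

lemma grid_error_le:
  assumes "N \<ge> 2" "\<And>ij. ij \<in> Omega_h N \<Longrightarrow> \<bar>v (grid_point N ij) - v\<^sub>h ij\<bar> \<le> c"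
  shows "grid_error N v v\<^sub>h \<le> c"
proof -
  have "(1, 1) \<in> Omega_h N" using assms(1) by (simp add: Omega_h_def)
  then show ?thesis using assms(2) finite_Omega_h
    by (auto simp: grid_error_def inf_norm_def intro!: Max.boundedI)
qed

text \<open>
  The restrictions of the exact state and adjoint state satisfy the scheme up to the truncation error
  of the stencil, so \<open>fd_scheme_difference\<close> bounds their distance to the discrete solution; the error
  of the control is that of the adjoint state divided by \<open>\<alpha>\<close>.
\<close>

theorem theorem2p1:
  fixes \<alpha> :: real and f g z u p :: "real \<times> real \<Rightarrow> real"
  assumes "\<alpha> > 0"
    and "continuous_on (closure Omega) f" and "continuous_on (closure Omega) g"
    and "optimality_system \<alpha> f g z u p"
    and "Ck_closure 4 Omega z" and "Ck_closure 4 Omega u" and "Ck_closure 4 Omega p"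
  shows "\<exists>C>0. \<forall>N\<ge>2.
           (\<exists>!(z\<^sub>h, u\<^sub>h, p\<^sub>h). fd_scheme \<alpha> f g N z\<^sub>h u\<^sub>h p\<^sub>h) \<and>
           (\<forall>z\<^sub>h u\<^sub>h p\<^sub>h. fd_scheme \<alpha> f g N z\<^sub>h u\<^sub>h p\<^sub>h \<longrightarrow>
              grid_error N z z\<^sub>h \<le> C * (1 / real N)\<^sup>2 \<and>
              grid_error N u u\<^sub>h \<le> C * (1 / real N)\<^sup>2 \<and>
              grid_error N p p\<^sub>h \<le> C * (1 / real N)\<^sup>2)"
proof -
  note al = assms(1)
  obtain Cz Cp where
    "\<forall>N. \<forall>ij\<in>Omega_h N. \<bar>laplacian z (grid_point N ij) -
        laplacian_h N (\<lambda>kl. z (grid_point N kl)) ij\<bar> \<le> Cz * (1 / real N)\<^sup>2"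
    "\<forall>N. \<forall>ij\<in>Omega_h N. \<bar>laplacian p (grid_point N ij) -
        laplacian_h N (\<lambda>kl. p (grid_point N kl)) ij\<bar> \<le> Cp * (1 / real N)\<^sup>2"
    using five_point_stencil_consistent[OF assms(5)] five_point_stencil_consistent[OF assms(7)]
    by blast
  moreover define D where "D = max 1 (max Cz Cp)"
  moreover have "Cz * (1 / real N)\<^sup>2 \<le> D * (1 / real N)\<^sup>2" "Cp * (1 / real N)\<^sup>2 \<le> D * (1 / real N)\<^sup>2" for N
    by (intro mult_right_mono; simp add: D_def)+
  ultimately have D:
    "\<bar>laplacian z (grid_point N ij) - laplacian_h N (\<lambda>kl. z (grid_point N kl)) ij\<bar> \<le> D * (1 / real N)\<^sup>2"
    "\<bar>laplacian p (grid_point N ij) - laplacian_h N (\<lambda>kl. p (grid_point N kl)) ij\<bar> \<le> D * (1 / real N)\<^sup>2"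
    if "ij \<in> Omega_h N" for N ij using that by (meson order_trans)+
  have D0: "D > 0" by (simp add: D_def)
  define c where "c = sqrt (2 + \<alpha> + 1 / \<alpha>) * D"
  have c: "c > 0" using al D0 by (simp add: c_def add_pos_pos)
  define C where "C = c + c / \<alpha>"
  have C: "C > 0" "c \<le> C" "c / \<alpha> \<le> C" using c al by (auto simp: C_def add_pos_pos)
  note sys = assms(4)[unfolded optimality_system_def]
  have err: "grid_error N z z\<^sub>h \<le> C * (1 / real N)\<^sup>2 \<and> grid_error N u u\<^sub>h \<le> C * (1 / real N)\<^sup>2 \<and>
      grid_error N p p\<^sub>h \<le> C * (1 / real N)\<^sup>2"
    if N: "N \<ge> 2" and s: "fd_scheme \<alpha> f g N z\<^sub>h u\<^sub>h p\<^sub>h" for N z\<^sub>h u\<^sub>h p\<^sub>h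
  proof -
    let ?Z = "grid_restriction N z" and ?P = "grid_restriction N p"
    have gf: "grid_function N ?Z" "grid_function N ?P"
      by (auto simp: grid_function_def grid_restriction_def)
    have u: "u (grid_point N ij) = p (grid_point N ij) / \<alpha>" "u\<^sub>h ij = p\<^sub>h ij / \<alpha>"
      if "ij \<in> Omega_h N" for ij
      using sys grid_point_in_Omega[OF that] s al that by (auto simp: fd_scheme_def field_simps)
    have 1: "\<bar>- laplacian_h N ?Z ij - ?P ij / \<alpha> - f (grid_point N ij)\<bar> \<le> D * (1 / real N)\<^sup>2"
      if "ij \<in> Omega_h N" for ij
    proof -
      have "f (grid_point N ij) = - laplacian z (grid_point N ij) - p (grid_point N ij) / \<alpha>"
        using sys grid_point_in_Omega[OF that] u(1)[OF that] by metis
      then show ?thesis using D(1)[OF that] laplacian_h_grid_restriction[OF _ that, of z] sys that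
        by (simp add: grid_restriction_def)
    qed
    have 2: "\<bar>- laplacian_h N ?P ij + ?Z ij - g (grid_point N ij)\<bar> \<le> D * (1 / real N)\<^sup>2"
      if "ij \<in> Omega_h N" for ij
    proof -
      have "g (grid_point N ij) = - laplacian p (grid_point N ij) + z (grid_point N ij)"
        using sys grid_point_in_Omega[OF that] by metis
      then show ?thesis using D(2)[OF that] laplacian_h_grid_restriction[OF _ that, of p] sys that
        by (simp add: grid_restriction_def)
    qed
    have zp: "\<bar>z (grid_point N ij) - z\<^sub>h ij\<bar> \<le> c * (1 / real N)\<^sup>2"
      "\<bar>p (grid_point N ij) - p\<^sub>h ij\<bar> \<le> c * (1 / real N)\<^sup>2" if "ij \<in> Omega_h N" for ij
      using fd_scheme_difference[OF al s gf, OF 1 2 that] that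
      by (simp_all add: grid_restriction_def c_def mult.assoc)
    have "\<bar>u (grid_point N ij) - u\<^sub>h ij\<bar> \<le> c / \<alpha> * (1 / real N)\<^sup>2" if "ij \<in> Omega_h N" for ij
    proof -
      have "\<bar>u (grid_point N ij) - u\<^sub>h ij\<bar> = \<bar>p (grid_point N ij) - p\<^sub>h ij\<bar> / \<alpha>"
        using al by (simp add: u[OF that] diff_divide_distrib[symmetric] abs_divide)
      then show ?thesis using zp(2)[OF that] al by (simp add: divide_right_mono)
    qed
    then have "grid_error N u u\<^sub>h \<le> c / \<alpha> * (1 / real N)\<^sup>2" by (intro grid_error_le N)
    moreover have "grid_error N z z\<^sub>h \<le> c * (1 / real N)\<^sup>2" "grid_error N p p\<^sub>h \<le> c * (1 / real N)\<^sup>2"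
      using zp by (intro grid_error_le N; simp)+
    moreover have "c * (1 / real N)\<^sup>2 \<le> C * (1 / real N)\<^sup>2" "c / \<alpha> * (1 / real N)\<^sup>2 \<le> C * (1 / real N)\<^sup>2"
      using C by (intro mult_right_mono; simp)+
    ultimately show ?thesis by linarith
  qed
  have ex1: "\<exists>!(z\<^sub>h, u\<^sub>h, p\<^sub>h). fd_scheme \<alpha> f g N z\<^sub>h u\<^sub>h p\<^sub>h" for N
  proof -
    obtain z\<^sub>h u\<^sub>h p\<^sub>h where s: "fd_scheme \<alpha> f g N z\<^sub>h u\<^sub>h p\<^sub>h" using fd_scheme_exists[OF al] by blast
    show ?thesis
    proof (rule ex1I[of _ "(z\<^sub>h, u\<^sub>h, p\<^sub>h)"])
      show "y = (z\<^sub>h, u\<^sub>h, p\<^sub>h)" if "case y of (z', u', p') \<Rightarrow> fd_scheme \<alpha> f g N z' u' p'" for y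
        using that fd_scheme_unique[OF al _ s] by (cases y) auto
    qed (simp add: s)
  qed
  show ?thesis using C(1) err ex1 by blast
qed

end
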